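(* Let $l=\{a_i;\ i=1,2,3,\dots\}$ be a sequence of real numbers, $a\in\mathbb{R}$, and $m$ a number. If $a=\mathrm{stat}\text{-}\lim l$ and $|a_i|<m$ for all $i\in\mathbb{N}$, then $\lim\sigma(l)=0$, i.e. $\lim_{n\to\infty}\sigma_n=0$.
   Context: $\mathbb{N}=\{1,2,3,\dots\}$. For $K\subseteq\mathbb{N}$ put $K_n=\{k\in K: k\le n\}$; the asymptotic density of $K$ is $d(K)=\lim_{n\to\infty}\frac1n|K_n|$ whenever the limit exists. A sequence $l=\{a_i\}$ of real numbers is statistically convergent to $a\in\mathbb{R}$, written $a=\mathrm{stat}\text{-}\lim l$, if for every $\varepsilon>0$ the set $\{i\in\mathbb{N}: |a_i-a|\ge\varepsilon\}$ has density $0$. The partial averages of $l$ are $\mu_n=\frac1n\sum_{i=1}^n a_i$, and the sequence of partial standard deviations is $\sigma(l)=\{\sigma_n;\ n=1,2,3,\dots\}$ with $\sigma_n=\left(\frac1n\sum_{i=1}^n(a_i-\mu_n)^2\right)^{1/2}$. *)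

theory Defs
  imports Complex_Main
begin

(* Indices run over the positive integers: sequences are functions on nat whose
   value at 0 is never used, and only the positive elements of an index set count. *)

definition initial_part :: "nat set \<Rightarrow> nat \<Rightarrow> nat set" where
  "initial_part K n = {k \<in> K. 1 \<le> k \<and> k \<le> n}"

(* The limit exists and equals d; the term at n = 0 is irrelevant. *)
definition has_asymptotic_density :: "nat set \<Rightarrow> real \<Rightarrow> bool" where
  "has_asymptotic_density K d \<longleftrightarrow>
     (\<lambda>n. 1 / real n * real (card (initial_part K n))) \<longlonglongrightarrow> d"

definition is_stat_lim :: "(nat \<Rightarrow> real) \<Rightarrow> real \<Rightarrow> bool" where
  "is_stat_lim l a \<longleftrightarrow>
     (\<forall>\<epsilon>>0. has_asymptotic_density {i. 1 \<le> i \<and> \<bar>l i - a\<bar> \<ge> \<epsilon>} 0)"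

definition partial_average :: "(nat \<Rightarrow> real) \<Rightarrow> nat \<Rightarrow> real" where
  "partial_average l n = 1 / real n * (\<Sum>i=1..n. l i)"

definition partial_std_dev :: "(nat \<Rightarrow> real) \<Rightarrow> nat \<Rightarrow> real" where
  "partial_std_dev l n =
     sqrt (1 / real n * (\<Sum>i=1..n. (l i - partial_average l n)\<^sup>2))"

end

theory Submission
  imports Defs
begin

text \<open>
  The average minimises the mean squared deviation from a constant, so
  \<open>\<sigma>\<^sub>n\<^sup>2\<close> is at most the mean of \<open>(l i - a)\<^sup>2\<close> over \<open>i \<le> n\<close>, where the unknown
  average no longer occurs. In that mean, the indices with \<open>\<bar>l i - a\<bar> < \<epsilon>\<close> contribute
  at most \<open>\<epsilon>\<^sup>2\<close>. Boundedness gives a constant \<open>B\<close> with \<open>\<bar>l i - a\<bar> \<le> B\<close>, so the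
  remaining indices contribute at most \<open>B\<^sup>2\<close> times their proportion among \<open>1, \<dots>, n\<close>,
  and this proportion tends to \<open>0\<close> by statistical convergence.
\<close>

text \<open>The cross term of the expansion around the average vanishes, because deviations
  from the average sum to zero.\<close>

lemma sum_squared_deviation_decomposition:
  assumes "n > 0"
  shows "(\<Sum>i=1..n. (l i - c)\<^sup>2) =
    (\<Sum>i=1..n. (l i - partial_average l n)\<^sup>2) + real n * (partial_average l n - c)\<^sup>2"
proof -
  define \<mu> where "\<mu> = partial_average l n"
  have "(\<Sum>i=1..n. l i) = real n * \<mu>"
    using assms by (simp add: \<mu>_def partial_average_def)
  then have deviations_cancel: "(\<Sum>i=1..n. l i - \<mu>) = 0"
    by (simp add: sum_subtractf)
  have "(\<Sum>i=1..n. (l i - c)\<^sup>2) =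
      (\<Sum>i=1..n. (l i - \<mu>)\<^sup>2 + 2 * (\<mu> - c) * (l i - \<mu>) + (\<mu> - c)\<^sup>2)"
    by (intro sum.cong refl) (simp add: power2_eq_square algebra_simps)
  also have "\<dots> = (\<Sum>i=1..n. (l i - \<mu>)\<^sup>2) + 2 * (\<mu> - c) * (\<Sum>i=1..n. l i - \<mu>)
      + real n * (\<mu> - c)\<^sup>2"
    by (simp only: sum.distrib sum_distrib_left[symmetric]) simp
  finally show ?thesis
    unfolding deviations_cancel by (simp add: \<mu>_def)
qed

lemma partial_average_minimises_mean_square:
  "1 / real n * (\<Sum>i=1..n. (l i - partial_average l n)\<^sup>2)
    \<le> 1 / real n * (\<Sum>i=1..n. (l i - c)\<^sup>2)"
proof (cases "n = 0")
  case False
  then show ?thesis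
    by (intro mult_left_mono)
      (simp_all only: sum_squared_deviation_decomposition[of n l c], simp_all)
qed simp

text \<open>A term is below \<open>\<epsilon>\<^sup>2\<close> off the exceptional set and at most \<open>B\<^sup>2\<close> on it, so each
  is bounded by \<open>\<epsilon>\<^sup>2\<close> plus \<open>B\<^sup>2\<close> times the indicator of that set.\<close>

lemma mean_square_le_exceptional_proportion:
  fixes l :: "nat \<Rightarrow> real"
  assumes bound: "\<And>i. i \<ge> 1 \<Longrightarrow> \<bar>l i - a\<bar> \<le> B"
  shows "1 / real n * (\<Sum>i=1..n. (l i - a)\<^sup>2)
    \<le> \<epsilon>\<^sup>2 + B\<^sup>2 * (1 / real n * real (card (initial_part {i. 1 \<le> i \<and> \<bar>l i - a\<bar> \<ge> \<epsilon>} n)))"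
proof (cases "n = 0")
  case False
  define K where "K = {i. 1 \<le> i \<and> \<bar>l i - a\<bar> \<ge> \<epsilon>}"
  have "(\<Sum>i=1..n. (l i - a)\<^sup>2) \<le> (\<Sum>i=1..n. \<epsilon>\<^sup>2 + (if i \<in> K then B\<^sup>2 else 0))"
  proof (rule sum_mono)
    fix i assume i: "i \<in> {1..n}"
    show "(l i - a)\<^sup>2 \<le> \<epsilon>\<^sup>2 + (if i \<in> K then B\<^sup>2 else 0)"
    proof (cases "i \<in> K")
      case True
      have "(l i - a)\<^sup>2 \<le> B\<^sup>2"
        using i power_mono[OF bound[of i], of 2] by simp
      then show ?thesis using True by (simp add: add_increasing)
    next
      case False
      then have "\<bar>l i - a\<bar> \<le> \<epsilon>" using i by (auto simp: K_def)
      from power_mono[OF this, of 2] show ?thesis using False by simp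
    qed
  qed
  also have "\<dots> = real n * \<epsilon>\<^sup>2 + B\<^sup>2 * real (card (initial_part K n))"
  proof -
    have "initial_part K n = {1..n} \<inter> K"
      by (auto simp: initial_part_def)
    then show ?thesis
      by (simp add: sum.distrib sum.If_cases)
  qed
  finally have "(\<Sum>i=1..n. (l i - a)\<^sup>2) \<le> real n * \<epsilon>\<^sup>2 + B\<^sup>2 * real (card (initial_part K n))" .
  then show ?thesis
    using False by (simp add: K_def field_simps)
qed simp

lemma mean_square_tendsto_0:
  assumes stat: "is_stat_lim l a"
    and bound: "\<And>i. i \<ge> 1 \<Longrightarrow> \<bar>l i - a\<bar> \<le> B"
  shows "(\<lambda>n. 1 / real n * (\<Sum>i=1..n. (l i - a)\<^sup>2)) \<longlonglongrightarrow> 0"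
proof (rule tendstoI)
  fix r :: real assume r: "r > 0"
  \<comment> \<open>Half of \<open>r\<close> absorbs the good indices, the other half the exceptional ones.\<close>
  define \<epsilon> where "\<epsilon> = sqrt (r / 2)"
  define p where
    "p n = 1 / real n * real (card (initial_part {i. 1 \<le> i \<and> \<bar>l i - a\<bar> \<ge> \<epsilon>} n))" for n
  have \<epsilon>: "\<epsilon> > 0" "\<epsilon>\<^sup>2 = r / 2"
    using r by (simp_all add: \<epsilon>_def)
  have "p \<longlonglongrightarrow> 0"
    using stat \<epsilon>(1) unfolding is_stat_lim_def has_asymptotic_density_def p_def by blast
  then have "(\<lambda>n. B\<^sup>2 * p n) \<longlonglongrightarrow> 0"
    by (rule tendsto_mult_right_zero)
  then have "\<forall>\<^sub>F n in sequentially. B\<^sup>2 * p n < r / 2"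
    by (rule order_tendstoD) (use r in simp)
  then show "\<forall>\<^sub>F n in sequentially. dist (1 / real n * (\<Sum>i=1..n. (l i - a)\<^sup>2)) 0 < r"
  proof (rule eventually_mono)
    fix n assume "B\<^sup>2 * p n < r / 2"
    moreover have "1 / real n * (\<Sum>i=1..n. (l i - a)\<^sup>2) \<le> \<epsilon>\<^sup>2 + B\<^sup>2 * p n"
      unfolding p_def by (rule mean_square_le_exceptional_proportion[OF bound])
    moreover have "0 \<le> 1 / real n * (\<Sum>i=1..n. (l i - a)\<^sup>2)"
      by (simp add: sum_nonneg)
    ultimately show "dist (1 / real n * (\<Sum>i=1..n. (l i - a)\<^sup>2)) 0 < r"
      unfolding dist_real_def \<epsilon>(2) by linarith
  qed
qed

theorem theorem2p3:
  fixes l :: "nat \<Rightarrow> real" and a m :: real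
  assumes "is_stat_lim l a"
    and "\<And>i. i \<ge> 1 \<Longrightarrow> \<bar>l i\<bar> < m"
  shows "partial_std_dev l \<longlonglongrightarrow> 0"
proof -
  have "\<bar>l i - a\<bar> \<le> m + \<bar>a\<bar>" if "i \<ge> 1" for i
    using assms(2)[OF that] by linarith
  then have "(\<lambda>n. 1 / real n * (\<Sum>i=1..n. (l i - a)\<^sup>2)) \<longlonglongrightarrow> 0"
    by (rule mean_square_tendsto_0[OF assms(1)])
  then have "(\<lambda>n. 1 / real n * (\<Sum>i=1..n. (l i - partial_average l n)\<^sup>2)) \<longlonglongrightarrow> 0"
    by (rule tendsto_sandwich[OF always_eventually always_eventually tendsto_const, rotated 2])
      (simp add: sum_nonneg, intro allI partial_average_minimises_mean_square)
  from tendsto_real_sqrt[OF this] show ?thesis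
    unfolding partial_std_dev_def by simp
qed

end
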